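(* Let $\lambda>0$ and $r>0$ be fixed, let $k\ge 0$ be a fixed integer, and let $W_{n,k}$ be the number of nodes of degree $k$ in the exponential random geometric graph $G_n(\lambda,r)$. Then $$\lim_{n\to\infty}\mathsf{E}(W_{n,k})=c^{-1},\qquad c=e^{\lambda r}-e^{-\lambda r};$$ in particular the limit is independent of $k$.
   Context: $G_n(\lambda,r)$ is the random graph with vertex set $\{X_1,\dots,X_n\}$, where $X_1,\dots,X_n$ are i.i.d. exponential random variables with mean $\lambda^{-1}$, and with an edge between $X_i$ and $X_j$ ($i\neq j$) if and only if $|X_i-X_j|\le r$. The degree of a node is the number of other nodes within distance $r$ of it. *)

theory Defs
  imports "HOL-Probability.Probability"
begin

text \<open>
  The random geometric graph on the points x 1, ..., x n is taken on the index set {1..n}: the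
  index i stands for the vertex x i, so that coinciding points (an event of probability 0 for a
  sample with a density) still count as distinct vertices.
\<close>

definition rgg_adj :: "real \<Rightarrow> (nat \<Rightarrow> real) \<Rightarrow> nat \<Rightarrow> nat \<Rightarrow> bool" where
  "rgg_adj r x i j \<longleftrightarrow> i \<noteq> j \<and> \<bar>x i - x j\<bar> \<le> r"

definition rgg_degree :: "nat \<Rightarrow> real \<Rightarrow> (nat \<Rightarrow> real) \<Rightarrow> nat \<Rightarrow> nat" where
  "rgg_degree n r x i = card {j \<in> {1..n}. rgg_adj r x i j}"

definition rgg_count_degree :: "nat \<Rightarrow> real \<Rightarrow> nat \<Rightarrow> (nat \<Rightarrow> real) \<Rightarrow> nat" where
  "rgg_count_degree n r k x = card {i \<in> {1..n}. rgg_degree n r x i = k}"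

end

theory Submission
  imports Defs "HOL-Real_Asymp.Real_Asymp"
begin

text \<open>
  Write \<open>p x\<close> for the probability that an exponential variable falls into \<open>[x - r, x + r]\<close>.
  Given \<open>X i = x\<close>, each of the other \<open>n - 1\<close> points is a neighbour of \<open>x\<close> independently with
  probability \<open>p x\<close>, so the degree of \<open>i\<close> is binomial and
  \<open>E W = n * \<integral> l exp (- l x) Bernstein (n - 1) k (p x) dx\<close>
  (\<open>expectation_count_degree\<close>).

  The integral is split at \<open>x = r\<close>. For \<open>x \<ge> r\<close> the interval does not meet the boundary of the
  half-line, and \<open>p x = c exp (- l x)\<close>, so that the derivative of \<open>p\<close> is \<open>- c\<close> times the density.
  Since \<open>n Bernstein (n - 1) k\<close> is minus the derivative of the binomial distribution function
  \<open>u \<mapsto> \<Sum>j\<le>k. Bernstein n j u\<close> (\<open>sum_Bernstein_deriv\<close>), this part equals exactly \<open>1 / c\<close> times the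
  probability that a binomial variable with parameters \<open>n\<close> and \<open>p r\<close> exceeds \<open>k\<close>. As \<open>p r\<close> is
  strictly between 0 and 1, that probability tends to 1, whatever \<open>k\<close> is. For \<open>0 \<le> x < r\<close> the
  probability \<open>p x\<close> is at least \<open>1 - exp (- l r)\<close>, so the integrand, factor \<open>n\<close> included, is bounded by
  a polynomial in \<open>n\<close> times a geometric sequence, and this part vanishes
  (\<open>Bernstein_interval_integral_bounds\<close>). Nodes of fixed degree thus come only from the far
  tail, where the points are sparse.
\<close>

section \<open>Binomial probabilities as functions of the success probability\<close>

lemma Bernstein_deriv:
  "((\<lambda>u. Bernstein n (Suc j) u) has_real_derivative
     real n * (Bernstein (n - 1) j u - Bernstein (n - 1) (Suc j) u)) (at u)"
proof (cases n)
  case 0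
  then show ?thesis by (auto simp: Bernstein_def)
next
  case (Suc m)
  have 1: "real (Suc m choose Suc j) * (real j + 1) = (real m + 1) * real (m choose j)"
    using Suc_times_binomial_eq[of m j] by (metis of_nat_Suc of_nat_mult add.commute mult.commute)
  have 2: "real (Suc m choose Suc j) * real (m - j) = (real m + 1) * real (m choose Suc j)"
  proof (cases "j < m")
    case True
    then have "Suc (Suc j) * (Suc m choose Suc (Suc j)) = Suc m * (m choose Suc j)"
      using Suc_times_binomial_eq[of m "Suc j"] by simp
    moreover have "(Suc m - Suc j) * (Suc m choose Suc j) = Suc m * (m choose Suc j)"
      using binomial_absorb_comp[of "Suc m" "Suc j"] by simp
    ultimately show ?thesis
      by (metis diff_Suc_Suc of_nat_Suc of_nat_mult add.commute mult.commute)
  qed auto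
  have "((\<lambda>u. Bernstein n (Suc j) u) has_real_derivative
     real (Suc m choose Suc j) * ((real j + 1) * u ^ j * (1 - u) ^ (m - j)
        - real (m - j) * (u ^ Suc j * (1 - u) ^ (m - Suc j)))) (at u)"
    unfolding Bernstein_def Suc
    by (rule derivative_eq_intros refl | simp add: algebra_simps)+
  also have "real (Suc m choose Suc j) * ((real j + 1) * u ^ j * (1 - u) ^ (m - j)
        - real (m - j) * (u ^ Suc j * (1 - u) ^ (m - Suc j)))
     = (real (Suc m choose Suc j) * (real j + 1)) * (u ^ j * (1 - u) ^ (m - j))
       - (real (Suc m choose Suc j) * real (m - j)) * (u ^ Suc j * (1 - u) ^ (m - Suc j))"
    by (simp add: algebra_simps)
  also have "\<dots> = real n * (Bernstein (n - 1) j u - Bernstein (n - 1) (Suc j) u)"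
    unfolding 1 2 by (simp add: Suc Bernstein_def algebra_simps)
  finally show ?thesis .
qed

text \<open>
  The derivatives of the single binomial probabilities telescope. The result is the density of the
  order statistic of rank \<open>k + 1\<close> among \<open>n\<close> uniform variables, up to the sign.
\<close>
lemma sum_Bernstein_deriv:
  "((\<lambda>u. \<Sum>j\<le>k. Bernstein n j u) has_real_derivative - real n * Bernstein (n - 1) k u) (at u)"
proof (induction k)
  case 0
  show ?case
    by (auto simp: Bernstein_def intro!: derivative_eq_intros)
next
  case (Suc k)
  show ?case
    using DERIV_add[OF Suc Bernstein_deriv[of n k u]] by (simp add: algebra_simps)
qed

text \<open>
  The bound includes \<open>k > n\<close>, where the summands with \<open>j > n\<close> vanish.
\<close>
lemma sum_Bernstein_le_1:
  assumes "0 \<le> u" "u \<le> 1"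
  shows "(\<Sum>j\<le>k. Bernstein n j u) \<le> 1"
proof -
  have "(\<Sum>j\<le>k. Bernstein n j u) \<le> (\<Sum>j\<le>max n k. Bernstein n j u)"
    using assms by (intro sum_mono2 Bernstein_nonneg) auto
  also have "\<dots> = (\<Sum>j\<le>n. Bernstein n j u)"
    by (intro sum.mono_neutral_right) (auto simp: Bernstein_def)
  finally show ?thesis by simp
qed

text \<open>
  For fixed \<open>k\<close> and \<open>q < 1\<close> the right-hand side decays geometrically in \<open>n\<close>, uniformly over all
  success probabilities that are at least \<open>1 - q\<close>.
\<close>
lemma Bernstein_le:
  assumes "0 \<le> u" "u \<le> 1" "1 - u \<le> q"
  shows "Bernstein n k u \<le> real n ^ k * q ^ (n - k)"
proof -
  have "real (n choose k) * u ^ k \<le> real (n choose k) * 1"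
    using assms by (intro mult_left_mono power_le_one) auto
  also have "\<dots> \<le> real n ^ k"
    by (metis of_nat_le_iff of_nat_power mult.right_neutral binomial_le_pow
        binomial_eq_0 not_le of_nat_0 zero_le_power of_nat_0_le_iff)
  finally show ?thesis
    unfolding Bernstein_def using assms by (intro mult_mono power_mono) auto
qed

lemma Bernstein_tendsto_0:
  assumes "0 < u" "u < 1"
  shows "(\<lambda>n. Bernstein n k u) \<longlonglongrightarrow> 0"
proof (rule tendsto_sandwich[OF _ _ tendsto_const])
  show "(\<lambda>n. real n ^ k * (1 - u) ^ (n - k)) \<longlonglongrightarrow> 0"
    using assms by real_asymp
qed (use assms in \<open>auto intro!: always_eventually Bernstein_nonneg Bernstein_le\<close>)

section \<open>The degree of a point is conditionally binomial\<close>

text \<open>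
  The binomial law of the number of coordinates that hit \<open>A\<close>: the event is the disjoint union, over
  the \<open>k\<close>-element sets \<open>S\<close> of coordinates, of the boxes on which exactly the coordinates in \<open>S\<close> hit.
\<close>
lemma emeasure_PiM_card_eq:
  assumes "prob_space D" "finite J" and A: "A \<in> sets D"
  shows "emeasure (Pi\<^sub>M J (\<lambda>_. D)) {y \<in> space (Pi\<^sub>M J (\<lambda>_. D)). card {j \<in> J. y j \<in> A} = k}
           = ennreal (Bernstein (card J) k (measure D A))"
proof -
  interpret D: prob_space D by fact
  interpret P: product_sigma_finite "\<lambda>_. D"
    by (simp add: product_sigma_finite_def D.sigma_finite_measure_axioms)
  define B where "B = (\<lambda>S. Pi\<^sub>E J (\<lambda>j. if j \<in> S then A else space D - A))"
  define SS where "SS = {S. S \<subseteq> J \<and> card S = k}"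
  let ?p = "measure D A"
  have fin: "finite SS"
    using assms(2) by (auto simp: SS_def)
  have B_iff: "y \<in> B S \<longleftrightarrow> y \<in> space (Pi\<^sub>M J (\<lambda>_. D)) \<and> {j \<in> J. y j \<in> A} = S" if "S \<subseteq> J" for y S
    using that sets.sets_into_space[OF A]
    by (auto simp: B_def space_PiM PiE_iff split: if_splits)
  have "{y \<in> space (Pi\<^sub>M J (\<lambda>_. D)). card {j \<in> J. y j \<in> A} = k} = (\<Union>S\<in>SS. B S)"
    by (auto simp: SS_def B_iff)
  also have "emeasure (Pi\<^sub>M J (\<lambda>_. D)) \<dots> = (\<Sum>S\<in>SS. emeasure (Pi\<^sub>M J (\<lambda>_. D)) (B S))"
  proof (rule sum_emeasure[symmetric, OF _ _ fin])
    show "B ` SS \<subseteq> sets (Pi\<^sub>M J (\<lambda>_. D))"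
      using A assms(2) by (auto simp: B_def intro!: sets_PiM_I_finite)
    show "disjoint_family_on B SS"
      unfolding disjoint_family_on_def
    proof (intro ballI impI)
      fix S T assume "S \<in> SS" "T \<in> SS" "S \<noteq> T"
      then have ST: "S \<subseteq> J" "T \<subseteq> J" by (simp_all add: SS_def)
      have "S = T" if "y \<in> B S" "y \<in> B T" for y
        using that(1)[unfolded B_iff[OF ST(1)]] that(2)[unfolded B_iff[OF ST(2)]] by simp
      then show "B S \<inter> B T = {}" using \<open>S \<noteq> T\<close> by blast
    qed
  qed
  also have "\<dots> = (\<Sum>S\<in>SS. ennreal (?p ^ k * (1 - ?p) ^ (card J - k)))"
  proof (rule sum.cong[OF refl])
    fix S assume "S \<in> SS"
    then have S: "S \<subseteq> J" "card S = k" by (auto simp: SS_def)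
    have "emeasure (Pi\<^sub>M J (\<lambda>_. D)) (B S) = (\<Prod>j\<in>J. emeasure D (if j \<in> S then A else space D - A))"
      unfolding B_def using A by (intro P.emeasure_PiM assms(2)) simp
    also have "\<dots> = (\<Prod>j\<in>J. ennreal (if j \<in> S then ?p else 1 - ?p))"
      using A by (intro prod.cong refl) (simp add: D.emeasure_eq_measure D.prob_compl)
    also have "\<dots> = ennreal (\<Prod>j\<in>J. if j \<in> S then ?p else 1 - ?p)"
      by (intro prod_ennreal) auto
    also have "(\<Prod>j\<in>J. if j \<in> S then ?p else 1 - ?p) = ?p ^ k * (1 - ?p) ^ (card J - k)"
      using assms(2) S
      by (simp add: prod.If_cases Int_absorb1 Diff_eq[symmetric] card_Diff_subset finite_subset)
    finally show "emeasure (Pi\<^sub>M J (\<lambda>_. D)) (B S) = ennreal (?p ^ k * (1 - ?p) ^ (card J - k))" .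
  qed
  also have "\<dots> = ennreal (Bernstein (card J) k ?p)"
    using n_subsets[OF assms(2), of k]
    by (simp add: SS_def Bernstein_def ennreal_of_nat_eq_real_of_nat ennreal_mult' mult.assoc)
  finally show ?thesis .
qed

lemma measurable_rgg_degree:
  assumes "i \<in> {1..n}"
  shows "(\<lambda>x. real (rgg_degree n r x i)) \<in> borel_measurable (Pi\<^sub>M {1..n} (\<lambda>_. borel))"
proof -
  have "real (rgg_degree n r x i) = (\<Sum>j\<in>{1..n} - {i}. if \<bar>x i - x j\<bar> \<le> r then 1 else 0)" for x
  proof -
    have "{j \<in> {1..n}. rgg_adj r x i j} = {j \<in> {1..n} - {i}. \<bar>x i - x j\<bar> \<le> r}"
      by (auto simp: rgg_adj_def)
    then show ?thesis
      by (simp add: rgg_degree_def sum.If_cases Int_def)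
  qed
  then show ?thesis
    using assms by simp measurable
qed

text \<open>
  Independence turns the joint law into a product measure, on which Fubini's theorem integrates out
  the coordinate \<open>i\<close> last. For a fixed value \<open>x\<close> of that coordinate, the degree counts the remaining
  \<open>n - 1\<close> coordinates that lie in \<open>[x - r, x + r]\<close>.
\<close>
lemma (in prob_space) emeasure_degree_eq:
  fixes X :: "nat \<Rightarrow> 'a \<Rightarrow> real"
  assumes ind: "indep_vars (\<lambda>_. borel) X {1..n}"
    and D: "\<And>j. j \<in> {1..n} \<Longrightarrow> distr M borel (X j) = D"
    and i: "i \<in> {1..n}"
  shows "emeasure M {\<omega> \<in> space M. rgg_degree n r (\<lambda>j. X j \<omega>) i = k}
           = (\<integral>\<^sup>+x. ennreal (Bernstein (n - 1) k (measure D {x - r..x + r})) \<partial>D)"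
    and "{\<omega> \<in> space M. rgg_degree n r (\<lambda>j. X j \<omega>) i = k} \<in> events"
proof -
  let ?I = "{1..n}" and ?J = "{1..n} - {i}"
  let ?P = "Pi\<^sub>M ?I (\<lambda>_. D)"
  have rv: "random_variable borel (X j)" if "j \<in> ?I" for j
    using ind that by (auto simp: indep_vars_def)
  have sets_D [measurable_cong]: "sets D = sets borel" and probD: "prob_space D"
    using D[OF i] prob_space_distr[OF rv[OF i]] by auto
  interpret D: prob_space D by (fact probD)
  interpret P: product_sigma_finite "\<lambda>_. D"
    by (simp add: product_sigma_finite_def D.sigma_finite_measure_axioms)
  have J: "finite ?J" "i \<notin> ?J" "insert i ?J = ?I" and cJ: "card ?J = n - 1"
    using i by auto
  have space_P: "space (Pi\<^sub>M A (\<lambda>_. D)) = PiE A (\<lambda>_. UNIV)" for A :: "nat set"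
    using sets_eq_imp_space_eq[OF sets_D] by (simp add: space_PiM)
  have sets_P: "sets ?P = sets (Pi\<^sub>M ?I (\<lambda>_. borel))"
    by (intro sets_PiM_cong) (auto simp: sets_D)
  have law: "distr M (Pi\<^sub>M ?I (\<lambda>_. borel)) (\<lambda>\<omega>. \<lambda>j\<in>?I. X j \<omega>) = ?P"
  proof -
    have "distr M (Pi\<^sub>M ?I (\<lambda>_. borel)) (\<lambda>\<omega>. \<lambda>j\<in>?I. X j \<omega>) = Pi\<^sub>M ?I (\<lambda>j. distr M borel (X j))"
      using ind rv i by (subst indep_vars_iff_distr_eq_PiM'[symmetric]) auto
    also have "\<dots> = ?P"
      by (intro PiM_cong D refl)
    finally show ?thesis .
  qed
  define E where "E = {x \<in> space (Pi\<^sub>M ?I (\<lambda>_. borel :: real measure)). rgg_degree n r x i = k}"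
  have E_borel: "E \<in> sets (Pi\<^sub>M ?I (\<lambda>_. borel))"
  proof -
    have "E = (\<lambda>x. real (rgg_degree n r x i)) -` {real k} \<inter> space (Pi\<^sub>M ?I (\<lambda>_. borel))"
      by (auto simp: E_def)
    then show ?thesis
      using measurable_sets[OF measurable_rgg_degree[OF i, of r], of "{real k}"] by simp
  qed
  then have E [measurable]: "E \<in> sets ?P"
    by (simp add: sets_P)
  have Xmeas: "(\<lambda>\<omega>. \<lambda>j\<in>?I. X j \<omega>) \<in> measurable M (Pi\<^sub>M ?I (\<lambda>_. borel))"
    using rv by (intro measurable_restrict) auto
  have ev: "{\<omega> \<in> space M. rgg_degree n r (\<lambda>j. X j \<omega>) i = k}
          = (\<lambda>\<omega>. \<lambda>j\<in>?I. X j \<omega>) -` E \<inter> space M"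
  proof -
    have "rgg_degree n r (\<lambda>j\<in>?I. X j \<omega>) i = rgg_degree n r (\<lambda>j. X j \<omega>) i" for \<omega>
      using i unfolding rgg_degree_def rgg_adj_def by (intro arg_cong[where f = card]) auto
    then show ?thesis
      by (auto simp: E_def space_PiM)
  qed
  show "{\<omega> \<in> space M. rgg_degree n r (\<lambda>j. X j \<omega>) i = k} \<in> events"
    unfolding ev by (rule measurable_sets[OF Xmeas E_borel])
  have "emeasure M {\<omega> \<in> space M. rgg_degree n r (\<lambda>j. X j \<omega>) i = k} = emeasure ?P E"
    unfolding ev law[symmetric] by (rule emeasure_distr[OF Xmeas E_borel, symmetric])
  also have "\<dots> = (\<integral>\<^sup>+x. indicator E x \<partial>Pi\<^sub>M (insert i ?J) (\<lambda>_. D))"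
    unfolding J(3) using E by (rule nn_integral_indicator[symmetric])
  also have "\<dots> = (\<integral>\<^sup>+x. (\<integral>\<^sup>+y. indicator E (y(i := x)) \<partial>Pi\<^sub>M ?J (\<lambda>_. D)) \<partial>D)"
    using E by (intro P.product_nn_integral_insert_rev J) (simp only: J(3) borel_measurable_indicator)
  also have "\<dots> = (\<integral>\<^sup>+x. ennreal (Bernstein (n - 1) k (measure D {x - r..x + r})) \<partial>D)"
  proof (rule nn_integral_cong)
    fix x
    let ?F = "{y \<in> space (Pi\<^sub>M ?J (\<lambda>_. D)). card {j \<in> ?J. y j \<in> {x - r..x + r}} = k}"
    have F: "y(i := x) \<in> E \<longleftrightarrow> y \<in> ?F" if "y \<in> space (Pi\<^sub>M ?J (\<lambda>_. D))" for y
    proof -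
      have "y(i := x) \<in> space (Pi\<^sub>M ?I (\<lambda>_. borel :: real measure))"
        using that i by (auto simp: space_P space_PiM PiE_iff extensional_def)
      moreover have "{j \<in> ?I. rgg_adj r (y(i := x)) i j} = {j \<in> ?J. y j \<in> {x - r..x + r}}"
        by (auto simp: rgg_adj_def)
      ultimately show ?thesis
        using that by (simp add: E_def rgg_degree_def)
    qed
    have F_sets: "?F \<in> sets (Pi\<^sub>M ?J (\<lambda>_. D))"
    proof -
      have "?F = (\<lambda>y. y(i := x)) -` E \<inter> space (Pi\<^sub>M ?J (\<lambda>_. D))"
        using F by blast
      also have "\<dots> \<in> sets (Pi\<^sub>M ?J (\<lambda>_. D))"
      proof (rule measurable_sets[OF _ E])
        show "(\<lambda>y. y(i := x)) \<in> measurable (Pi\<^sub>M ?J (\<lambda>_. D)) ?P"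
        proof (rule measurable_fun_upd)
          show "?I = ?J \<union> {i}" using i by auto
        qed (use sets_eq_imp_space_eq[OF sets_D] in auto)
      qed
      finally show ?thesis .
    qed
    have "(\<integral>\<^sup>+y. indicator E (y(i := x)) \<partial>Pi\<^sub>M ?J (\<lambda>_. D)) = (\<integral>\<^sup>+y. indicator ?F y \<partial>Pi\<^sub>M ?J (\<lambda>_. D))"
      using F by (intro nn_integral_cong) (auto split: split_indicator)
    also have "\<dots> = emeasure (Pi\<^sub>M ?J (\<lambda>_. D)) ?F"
      using F_sets by simp
    also have "\<dots> = ennreal (Bernstein (n - 1) k (measure D {x - r..x + r}))"
      unfolding cJ[symmetric]
      by (rule emeasure_PiM_card_eq[OF probD J(1)]) (simp add: sets_D)
    finally show "(\<integral>\<^sup>+y. indicator E (y(i := x)) \<partial>Pi\<^sub>M ?J (\<lambda>_. D)) = \<dots>" .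
  qed
  finally show "emeasure M {\<omega> \<in> space M. rgg_degree n r (\<lambda>j. X j \<omega>) i = k}
           = (\<integral>\<^sup>+x. ennreal (Bernstein (n - 1) k (measure D {x - r..x + r})) \<partial>D)" .
qed

text \<open>
  The expectation is stated in the extended nonnegative reals, where neither integrability nor
  finiteness of the right-hand side has to be discussed.
\<close>
lemma (in prob_space) expectation_count_degree:
  fixes X :: "nat \<Rightarrow> 'a \<Rightarrow> real"
  assumes ind: "indep_vars (\<lambda>_. borel) X {1..n}"
    and D: "\<And>j. j \<in> {1..n} \<Longrightarrow> distr M borel (X j) = D"
  shows "ennreal (expectation (\<lambda>\<omega>. real (rgg_count_degree n r k (\<lambda>j. X j \<omega>))))
           = of_nat n * (\<integral>\<^sup>+x. ennreal (Bernstein (n - 1) k (measure D {x - r..x + r})) \<partial>D)"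
proof -
  define A where "A = (\<lambda>i. {\<omega> \<in> space M. rgg_degree n r (\<lambda>j. X j \<omega>) i = k})"
  have A: "emeasure M (A i) = (\<integral>\<^sup>+x. ennreal (Bernstein (n - 1) k (measure D {x - r..x + r})) \<partial>D)"
      "A i \<in> events" if "i \<in> {1..n}" for i
    unfolding A_def using emeasure_degree_eq[OF ind D that] by auto
  have "expectation (\<lambda>\<omega>. real (rgg_count_degree n r k (\<lambda>j. X j \<omega>)))
      = expectation (\<lambda>\<omega>. \<Sum>i\<in>{1..n}. indicator (A i) \<omega>)"
  proof (rule Bochner_Integration.integral_cong[OF refl])
    fix \<omega> assume "\<omega> \<in> space M"
    then have "(\<Sum>i\<in>{1..n}. indicator (A i) \<omega>)
        = (\<Sum>i\<in>{1..n}. if rgg_degree n r (\<lambda>j. X j \<omega>) i = k then 1 else 0 :: real)"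
      by (intro sum.cong) (auto simp: A_def)
    then show "real (rgg_count_degree n r k (\<lambda>j. X j \<omega>)) = (\<Sum>i\<in>{1..n}. indicator (A i) \<omega>)"
      by (simp add: rgg_count_degree_def sum.If_cases Int_def)
  qed
  also have "\<dots> = (\<Sum>i\<in>{1..n}. prob (A i))"
    using A(2) by (subst Bochner_Integration.integral_sum) (auto intro!: sum.cong simp: less_top[symmetric])
  also have "ennreal \<dots> = (\<Sum>i\<in>{1..n}. emeasure M (A i))"
    by (simp add: emeasure_eq_measure sum_ennreal)
  also have "\<dots> = of_nat n * (\<integral>\<^sup>+x. ennreal (Bernstein (n - 1) k (measure D {x - r..x + r})) \<partial>D)"
    using A(1) by simp
  finally show ?thesis .
qed

section \<open>The integral for the exponential law\<close>

lemma measurable_measure_interval: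
  fixes D :: "real measure"
  assumes "prob_space D" and sets_D [measurable_cong]: "sets D = sets borel"
  shows "(\<lambda>x. measure D {x - r..x + r}) \<in> borel_measurable borel"
proof -
  interpret prob_space D by fact
  have "{z \<in> space (borel \<Otimes>\<^sub>M D). fst z - r \<le> snd z \<and> snd z \<le> fst z + r} \<in> sets (borel \<Otimes>\<^sub>M D)"
    by measurable
  from measurable_emeasure_Pair[OF this]
  have "(\<lambda>x. emeasure D {x - r..x + r}) \<in> borel_measurable borel"
    using sets_eq_imp_space_eq[OF sets_D]
    by (simp add: vimage_def space_pair_measure atLeastAtMost_def atLeast_def atMost_def Int_def)
  then show ?thesis
    unfolding measure_def by measurable
qed

text \<open>
  The maximum accounts for the boundary: the part of the interval below 0 carries no mass.
\<close>
lemma measure_exponential_ball: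
  assumes "0 < l" "0 < r" "0 \<le> x"
  shows "measure (density lborel (exponential_density l)) {x - r..x + r}
           = exp (- (l * max 0 (x - r))) - exp (- (l * (x + r)))"
proof -
  define a where "a = max 0 (x - r)"
  have a: "0 \<le> a" "a \<le> x + r"
    using assms by (auto simp: a_def)
  have "emeasure (density lborel (exponential_density l)) {x - r..x + r}
      = (\<integral>\<^sup>+y. ennreal (exponential_density l y) * indicator {x - r..x + r} y \<partial>lborel)"
    by (subst emeasure_density) auto
  also have "\<dots> = (\<integral>\<^sup>+y. ennreal (l * exp (- y * l)) * indicator {a..x + r} y \<partial>lborel)"
    by (intro nn_integral_cong) (auto simp: exponential_density_def a_def split: split_indicator)
  also have "\<dots> = ennreal (- exp (- (l * (x + r))) - (- exp (- (l * a))))"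
    using assms a
    by (intro nn_integral_FTC_Icc) (auto intro!: derivative_eq_intros simp: mult_ac)
  finally show ?thesis
    using assms a by (simp add: measure_def a_def[symmetric])
qed

text \<open>
  With \<open>a = l * r\<close> this number is the hitting probability of \<open>[0, 2 * r]\<close>, the interval around the
  point \<open>r\<close> at which the integral is split.
\<close>
lemma exp_gap_mult_exp_minus_bounds:
  fixes a :: real
  assumes "0 < a"
  shows "0 < (exp a - exp (- a)) * exp (- a)" "(exp a - exp (- a)) * exp (- a) < 1"
proof -
  have "(exp a - exp (- a)) * exp (- a) = 1 - exp (- 2 * a)"
    by (simp add: left_diff_distrib flip: exp_add)
  then show "0 < (exp a - exp (- a)) * exp (- a)" "(exp a - exp (- a)) * exp (- a) < 1"
    using assms by simp_all
qed

text \<open>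
  The lower bound is the exact contribution of \<open>[r, \<infinity>)\<close>, obtained from an explicit antiderivative;
  the second summand of the upper bound dominates the contribution of the boundary zone \<open>[0, r)\<close>.
  The argument \<open>c * q\<close> is the hitting probability at \<open>x = r\<close>, the end point of the
  substitution \<open>u = c * exp (- (l * x))\<close>, which sends \<open>x = \<infinity>\<close> to \<open>u = 0\<close>.
\<close>
lemma Bernstein_interval_integral_bounds:
  fixes l r :: real and n k :: nat
  assumes "0 < l" "0 < r"
  defines "D \<equiv> density lborel (exponential_density l)"
    and "c \<equiv> exp (l * r) - exp (- (l * r))"
    and "q \<equiv> exp (- (l * r))"
  defines "V \<equiv> of_nat n * (\<integral>\<^sup>+x. ennreal (Bernstein (n - 1) k (measure D {x - r..x + r})) \<partial>D)"
  shows "ennreal ((1 - (\<Sum>j\<le>k. Bernstein n j (c * q))) / c) \<le> V"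
    and "V \<le> ennreal ((1 - (\<Sum>j\<le>k. Bernstein n j (c * q))) / c
              + real n * (real (n - 1) ^ k * q ^ (n - 1 - k)))"
proof -
  interpret D: prob_space D
    unfolding D_def using prob_space_exponential_density[OF assms(1)] .
  have sets_D: "sets D = sets borel"
    by (simp add: D_def)
  have q: "0 < q" "q < 1" and c: "0 < c"
    using assms by (auto simp: q_def c_def)
  let ?p = "\<lambda>x. measure D {x - r..x + r}"
  define b where "b = (\<lambda>x. real n * Bernstein (n - 1) k (?p x))"
  define m where "m = real n * (real (n - 1) ^ k * q ^ (n - 1 - k))"
  have b_nonneg: "0 \<le> b x" for x
    by (auto simp: b_def intro!: mult_nonneg_nonneg Bernstein_nonneg)
  have p_ge: "?p x = c * exp (- (l * x))" if "r \<le> x" for x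
    using measure_exponential_ball[of l r x] that assms
    by (simp add: c_def D_def algebra_simps flip: exp_add)
  have b_le: "b x \<le> m" if "0 \<le> x" "x < r" for x
  proof -
    have "exp (- (l * (x + r))) \<le> q"
      using assms that by (simp add: q_def)
    then have "1 - ?p x \<le> q"
      using measure_exponential_ball[of l r x] that assms by (simp add: D_def max_def)
    then show ?thesis
      unfolding b_def m_def by (intro mult_left_mono Bernstein_le) auto
  qed
  define S where "S = (\<lambda>u. \<Sum>j\<le>k. Bernstein n j u)"
  define f where "f = (\<lambda>x. l * exp (- (l * x)) * (real n * Bernstein (n - 1) k (c * exp (- (l * x)))))"
  have fp: "ennreal (exponential_density l x) * ennreal (b x) = ennreal (f x)" if "r \<le> x" for x
  proof -
    have "ennreal (exponential_density l x) * ennreal (b x) = ennreal (exponential_density l x * b x)"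
      using b_nonneg by (simp add: ennreal_mult'')
    also have "exponential_density l x * b x = f x"
      using that assms p_ge[OF that] by (simp add: f_def b_def exponential_density_def mult_ac)
    finally show ?thesis .
  qed
  \<comment> \<open>A binomial variable with success probability 0 is 0, hence at most \<open>k\<close>; this is the value of
    the antiderivative at infinity.\<close>
  have S0: "S 0 = 1"
  proof -
    have "S 0 = (\<Sum>j\<le>k. if j = 0 then 1 else 0)"
      unfolding S_def by (intro sum.cong) (auto simp: Bernstein_def)
    then show ?thesis by simp
  qed
  have tail: "(\<integral>\<^sup>+x. ennreal (f x) * indicator {r..} x \<partial>lborel) = ennreal (1 / c - S (c * q) / c)"
  proof -
    have "(\<integral>\<^sup>+x. ennreal (f x) * indicator {r..} x \<partial>lborel) = ennreal (1 / c - S (c * exp (- (l * r))) / c)"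
    proof (rule nn_integral_FTC_atLeast)
      show "f \<in> borel_measurable borel"
        unfolding f_def Bernstein_def by measurable
      show "((\<lambda>x. S (c * exp (- (l * x))) / c) has_real_derivative f x) (at x)" for x
      proof -
        have "((\<lambda>x. c * exp (- (l * x))) has_real_derivative - l * (c * exp (- (l * x)))) (at x)"
          by (auto intro!: derivative_eq_intros)
        from DERIV_cdivide[OF DERIV_chain2[OF sum_Bernstein_deriv this, of n k], of c]
        show ?thesis
          unfolding S_def f_def using c by (simp add: mult_ac)
      qed
      show "0 \<le> f x" if "r \<le> x" for x
      proof -
        have "f x = l * exp (- (l * x)) * b x"
          using p_ge[OF that] by (simp add: f_def b_def)
        then show ?thesis using b_nonneg[of x] assms by simp
      qed
      have "isCont S 0"
        unfolding S_def using DERIV_isCont[OF sum_Bernstein_deriv] .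
      moreover have "((\<lambda>x. c * exp (- (l * x))) \<longlongrightarrow> 0) at_top"
        using assms c by real_asymp
      ultimately have "((\<lambda>x. S (c * exp (- (l * x)))) \<longlongrightarrow> S 0) at_top"
        by (rule isCont_tendsto_compose)
      then show "((\<lambda>x. S (c * exp (- (l * x))) / c) \<longlongrightarrow> 1 / c) at_top"
        using c by (intro tendsto_intros) (auto simp: S0)
    qed
    then show ?thesis by (simp add: q_def)
  qed
  have b_meas: "(\<lambda>x. ennreal (b x)) \<in> borel_measurable borel"
    unfolding b_def Bernstein_def
    using measurable_measure_interval[OF D.prob_space_axioms sets_D, of r] by measurable
  have V: "V = (\<integral>\<^sup>+x. ennreal (exponential_density l x) * ennreal (b x) \<partial>lborel)"
  proof -
    have "(\<lambda>x. ennreal (Bernstein (n - 1) k (?p x))) \<in> borel_measurable D"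
      unfolding Bernstein_def measurable_cong_sets[OF sets_D refl]
      using measurable_measure_interval[OF D.prob_space_axioms sets_D, of r] by measurable
    then have "V = (\<integral>\<^sup>+x. of_nat n * ennreal (Bernstein (n - 1) k (?p x)) \<partial>D)"
      unfolding V_def by (rule nn_integral_cmult[symmetric])
    also have "\<dots> = (\<integral>\<^sup>+x. ennreal (b x) \<partial>D)"
      unfolding b_def ennreal_of_nat_eq_real_of_nat by (simp add: ennreal_mult')
    also have "\<dots> = (\<integral>\<^sup>+x. ennreal (exponential_density l x) * ennreal (b x) \<partial>lborel)"
      using b_meas unfolding D_def by (intro nn_integral_density) simp_all
    finally show ?thesis .
  qed
  have tail': "(\<integral>\<^sup>+x. ennreal (f x) * indicator {r..} x \<partial>lborel) = ennreal ((1 - S (c * q)) / c)"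
    by (simp add: tail diff_divide_distrib)
  have "ennreal ((1 - S (c * q)) / c) \<le> V"
    unfolding V tail'[symmetric]
    by (intro nn_integral_mono) (auto simp: fp split: split_indicator)
  then show "ennreal ((1 - (\<Sum>j\<le>k. Bernstein n j (c * q))) / c) \<le> V"
    unfolding S_def .
  \<comment> \<open>The bound \<open>m\<close> for the boundary zone is added on the whole half-line, because the density
    integrates to 1 there.\<close>
  have "V \<le> (\<integral>\<^sup>+x. ennreal (f x) * indicator {r..} x + ennreal (exponential_density l x) * ennreal m \<partial>lborel)"
    unfolding V
  proof (intro nn_integral_mono)
    fix x
    show "ennreal (exponential_density l x) * ennreal (b x)
        \<le> ennreal (f x) * indicator {r..} x + ennreal (exponential_density l x) * ennreal m"
    proof (cases "r \<le> x")
      case True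
      then show ?thesis by (simp add: fp)
    next
      case False
      then show ?thesis
        using b_le[of x]
        by (cases "x < 0") (auto simp: exponential_density_def intro!: mult_left_mono ennreal_leI)
    qed
  qed
  also have "\<dots> = (\<integral>\<^sup>+x. ennreal (f x) * indicator {r..} x \<partial>lborel)
      + (\<integral>\<^sup>+x. ennreal (exponential_density l x) * ennreal m \<partial>lborel)"
    by (intro nn_integral_add) (auto simp: f_def Bernstein_def)
  also have "(\<integral>\<^sup>+x. ennreal (exponential_density l x) * ennreal m \<partial>lborel) = ennreal m"
  proof -
    have "(\<integral>\<^sup>+x. ennreal (exponential_density l x) * ennreal m \<partial>lborel) = (\<integral>\<^sup>+x. ennreal m \<partial>D)"
      unfolding D_def by (rule nn_integral_density[symmetric]) auto
    then show ?thesis by (simp add: D.emeasure_space_1)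
  qed
  also have "(\<integral>\<^sup>+x. ennreal (f x) * indicator {r..} x \<partial>lborel) + ennreal m
      = ennreal ((1 - S (c * q)) / c + m)"
  proof -
    have "0 \<le> c * q" "c * q \<le> 1"
      using exp_gap_mult_exp_minus_bounds[of "l * r"] assms(1,2) by (simp_all add: c_def q_def less_imp_le)
    then have "S (c * q) \<le> 1"
      unfolding S_def by (rule sum_Bernstein_le_1)
    then show ?thesis
      unfolding tail' using c q by (intro ennreal_plus[symmetric]) (auto simp: m_def)
  qed
  finally show "V \<le> ennreal ((1 - (\<Sum>j\<le>k. Bernstein n j (c * q))) / c
              + real n * (real (n - 1) ^ k * q ^ (n - 1 - k)))"
    unfolding S_def m_def .
qed

section \<open>The limit of the expected number of nodes of a given degree\<close>

theorem theorem4: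
  fixes M :: "nat \<Rightarrow> 'a measure"
    and X :: "nat \<Rightarrow> nat \<Rightarrow> 'a \<Rightarrow> real"
    and l r :: real and k :: nat
  assumes "l > 0" and "r > 0"
    and "\<And>n. prob_space (M n)"
    and "\<And>n. prob_space.indep_vars (M n) (\<lambda>_. borel) (X n) {1..n}"
    and "\<And>n i. i \<in> {1..n} \<Longrightarrow> distributed (M n) lborel (X n i) (exponential_density l)"
  shows "(\<lambda>n. prob_space.expectation (M n)
             (\<lambda>\<omega>. real (rgg_count_degree n r k (\<lambda>i. X n i \<omega>))))
           \<longlonglongrightarrow> inverse (exp (l * r) - exp (- (l * r)))"
proof -
  define c q where "c = exp (l * r) - exp (- (l * r))" and "q = exp (- (l * r))"
  define EW where "EW = (\<lambda>n. prob_space.expectation (M n)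
             (\<lambda>\<omega>. real (rgg_count_degree n r k (\<lambda>i. X n i \<omega>))))"
  define lo where "lo = (\<lambda>n. (1 - (\<Sum>j\<le>k. Bernstein n j (c * q))) / c)"
  define err where "err = (\<lambda>n. real n * (real (n - 1) ^ k * q ^ (n - 1 - k)))"
  have q: "0 < q" "q < 1" and c: "0 < c"
    using assms(1,2) by (auto simp: q_def c_def)
  have cq: "0 < c * q" "c * q < 1"
    using exp_gap_mult_exp_minus_bounds[of "l * r"] assms(1,2) by (simp_all add: c_def q_def)
  have bounds: "lo n \<le> EW n \<and> EW n \<le> lo n + err n" for n
  proof -
    interpret prob_space "M n" by (fact assms(3))
    have law: "distr (M n) borel (X n j) = density lborel (exponential_density l)"
      if "j \<in> {1..n}" for j
      using distributed_distr_eq_density[OF assms(5)[OF that]] by (simp cong: distr_cong)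
    have EW: "ennreal (EW n) = of_nat n * (\<integral>\<^sup>+x. ennreal (Bernstein (n - 1) k
        (measure (density lborel (exponential_density l)) {x - r..x + r})) \<partial>density lborel (exponential_density l))"
      unfolding EW_def by (rule expectation_count_degree[OF assms(4) law])
    \<comment> \<open>Nonnegativity is what allows the bounds to be read back from the extended reals.\<close>
    have "0 \<le> EW n"
      unfolding EW_def by (rule Bochner_Integration.integral_nonneg) simp
    moreover have "ennreal (lo n) \<le> ennreal (EW n)" "ennreal (EW n) \<le> ennreal (lo n + err n)"
      using Bernstein_interval_integral_bounds[OF assms(1,2), of n k]
      unfolding EW lo_def err_def c_def q_def by blast+
    moreover have "0 \<le> err n"
      using q by (simp add: err_def)
    moreover have "0 \<le> lo n"
      using sum_Bernstein_le_1[of "c * q" n k] c cq by (simp add: lo_def)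
    ultimately show ?thesis
      by (simp add: ennreal_le_iff del: ennreal_plus)
  qed
  have lo: "lo \<longlonglongrightarrow> inverse c"
  proof -
    have "(\<lambda>n. (1 - (\<Sum>j\<le>k. Bernstein n j (c * q))) / c) \<longlonglongrightarrow> (1 - (\<Sum>j\<le>k. 0)) / c"
      using c by (intro tendsto_intros Bernstein_tendsto_0 cq) auto
    then show ?thesis by (simp add: lo_def inverse_eq_divide)
  qed
  have err: "err \<longlonglongrightarrow> 0"
    unfolding err_def using q by real_asymp
  have "EW \<longlonglongrightarrow> inverse c"
  proof (rule tendsto_sandwich[OF _ _ lo])
    show "(\<lambda>n. lo n + err n) \<longlonglongrightarrow> inverse c"
      using tendsto_add[OF lo err] by simp
    show "eventually (\<lambda>n. lo n \<le> EW n) sequentially" "eventually (\<lambda>n. EW n \<le> lo n + err n) sequentially"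
      by (simp_all add: bounds)
  qed
  then show ?thesis
    unfolding EW_def c_def .
qed

end
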